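(* Let $\mathcal{U}=\{U_i\}_{i\in I}$ be a cover of a set $X$, let $P_X$ be a partition of $X$ and let $P_I$ be a partition of $I$. Then $$\mathrm{CoNrv}(\mathcal{U})/P_X=\mathrm{CoNrv}(\mathcal{U}/P_X),\qquad \mathrm{Nrv}(\mathcal{U})/P_I=\mathrm{Nrv}(\mathcal{U}/P_I).$$
   Context: A cover of $X$ is an indexed family $\mathcal{U}=\{U_i\}_{i\in I}$ of sets with $X=\bigcup_{i\in I}U_i$. The co-nerve $\mathrm{CoNrv}(\mathcal{U})$ is the simplicial complex whose simplices are the finite nonempty $\sigma\subseteq X$ with $\sigma\subseteq U_i$ for some $i\in I$. The nerve $\mathrm{Nrv}(\mathcal{U})$ is the simplicial complex whose simplices are the finite nonempty $\sigma\subseteq I$ with $\bigcap_{i\in\sigma}U_i\ne\emptyset$. For a partition $P$ of a set $V$ write $V/P$ for the set of blocks and $q:V\to V/P$ for the projection. If $K$ is a simplicial complex on vertex set $V$, the quotient complex is $K/P=\{q(\sigma)\mid\sigma\in K\}$, a simplicial complex on $V/P$. With $q_X:X\to X/P_X$ the projection, the quotient cover on the space is the cover of $X/P_X$ given by $\mathcal{U}/P_X=\{q_X(U_i)\}_{i\in I}$ (indexed by $I$). The quotient cover on the index set is the cover of $X$ given by $\mathcal{U}/P_I=\{\bigcup_{i'\in[i]}U_{i'}\}_{[i]\in I/P_I}$ (indexed by $I/P_I$). *)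

theory Defs
  imports Main "HOL-Library.Disjoint_Sets"
begin

text \<open>
  An indexed family is a function \<open>U\<close> restricted to an explicit index set \<open>I\<close>; values of \<open>U\<close>
  outside \<open>I\<close> are irrelevant. The members and the index set may be empty.
\<close>

definition cover :: "'a set \<Rightarrow> 'i set \<Rightarrow> ('i \<Rightarrow> 'a set) \<Rightarrow> bool" where
  "cover X I U \<longleftrightarrow> X = (\<Union>i\<in>I. U i)"

text \<open>A simplicial complex is represented by its set of (finite nonempty) simplices.\<close>

definition co_nerve :: "'a set \<Rightarrow> 'i set \<Rightarrow> ('i \<Rightarrow> 'a set) \<Rightarrow> 'a set set" where
  "co_nerve X I U = {\<sigma>. finite \<sigma> \<and> \<sigma> \<noteq> {} \<and> \<sigma> \<subseteq> X \<and> (\<exists>i\<in>I. \<sigma> \<subseteq> U i)}"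

definition nerve :: "'i set \<Rightarrow> ('i \<Rightarrow> 'a set) \<Rightarrow> 'i set set" where
  "nerve I U = {\<sigma>. finite \<sigma> \<and> \<sigma> \<noteq> {} \<and> \<sigma> \<subseteq> I \<and> (\<Inter>i\<in>\<sigma>. U i) \<noteq> {}}"

text \<open>
  A partition of \<open>V\<close> is a set \<open>P\<close> of blocks with \<open>partition_on V P\<close>, so the set of blocks
  \<open>V/P\<close> is \<open>P\<close> itself. The projection is meaningful only on \<open>V\<close>.
\<close>

definition block_proj :: "'a set set \<Rightarrow> 'a \<Rightarrow> 'a set" where
  "block_proj P x = (THE B. B \<in> P \<and> x \<in> B)"

definition quotient_complex :: "'a set set \<Rightarrow> 'a set set \<Rightarrow> 'a set set set" where
  "quotient_complex P K = {block_proj P ` \<sigma> | \<sigma>. \<sigma> \<in> K}"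

definition quotient_cover_space :: "'a set set \<Rightarrow> ('i \<Rightarrow> 'a set) \<Rightarrow> 'i \<Rightarrow> 'a set set" where
  "quotient_cover_space P U = (\<lambda>i. block_proj P ` U i)"

text \<open>The index set of the following family is the set of blocks of a partition of \<open>I\<close>.\<close>

definition quotient_cover_index :: "('i \<Rightarrow> 'a set) \<Rightarrow> 'i set \<Rightarrow> 'a set" where
  "quotient_cover_index U = (\<lambda>B. \<Union>i\<in>B. U i)"

lemma block_proj_eq:
  assumes "partition_on V P" "B \<in> P" "x \<in> B"
  shows "block_proj P x = B"
  unfolding block_proj_def
  using assms by (intro the_equality) (auto simp: partition_on_def disjoint_def)

lemma block_proj_image:
  assumes "partition_on V P"
  shows "block_proj P ` V = P"
proof
  show "block_proj P ` V \<subseteq> P"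
  proof
    fix B assume "B \<in> block_proj P ` V"
    then obtain x where x: "x \<in> V" "B = block_proj P x" by blast
    then obtain C where "C \<in> P" "x \<in> C" using assms by (auto simp: partition_on_def)
    then show "B \<in> P" using x block_proj_eq[OF assms] by simp
  qed
  show "P \<subseteq> block_proj P ` V"
  proof
    fix B assume B: "B \<in> P"
    then obtain x where x: "x \<in> B" using assms by (metis all_not_in_conv partition_on_def)
    then have "x \<in> V" using B assms by (auto simp: partition_on_def)
    then show "B \<in> block_proj P ` V" using block_proj_eq[OF assms B x] by blast
  qed
qed

lemma cover_quotient_cover_space:
  assumes "cover X I U" "partition_on X P"
  shows "cover P I (quotient_cover_space P U)"
  using assms(1) block_proj_image[OF assms(2)]
  unfolding cover_def quotient_cover_space_def by (metis image_UN)

lemma cover_quotient_cover_index: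
  assumes "cover X I U" "partition_on I P"
  shows "cover X P (quotient_cover_index U)"
  using assms unfolding cover_def quotient_cover_index_def partition_on_def by auto

end

theory Submission
  imports Defs
begin

text \<open>Both equalities say that simplices can be pushed forward along the projection and finite
  simplices of the quotient can be lifted back. Pushing forward preserves the witness: the same
  \<open>U i\<close> in the co-nerve, the same common point in the nerve, since merging indices only
  enlarges the members. Lifting uses finiteness for the co-nerve
  (\<open>quotient_complex_co_nerve\<close>), where a finite subset of the image of
  \<open>U i\<close> comes from a finite subset of \<open>U i\<close>. For the nerve
  (\<open>quotient_complex_nerve\<close>) one picks from each block an index whose member contains
  the common point.\<close>

lemma mem_block_proj:
  assumes "partition_on V P" "x \<in> V"
  shows "x \<in> block_proj P x"
proof -
  obtain B where "B \<in> P" "x \<in> B" using assms by (auto simp: partition_on_def)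
  then show ?thesis using block_proj_eq[OF assms(1)] by simp
qed

text \<open>The lift is taken inside the single member \<open>U i\<close> whose image contains
  \<open>\<tau>\<close>; an arbitrary set of representatives of the blocks in \<open>\<tau>\<close>
  could fail to lie in any one member.\<close>

lemma quotient_complex_co_nerve:
  assumes "cover X I U" "partition_on X P"
  shows "quotient_complex P (co_nerve X I U) = co_nerve P I (quotient_cover_space P U)"
proof
  show "quotient_complex P (co_nerve X I U) \<subseteq> co_nerve P I (quotient_cover_space P U)"
  proof
    fix \<tau> assume "\<tau> \<in> quotient_complex P (co_nerve X I U)"
    then obtain \<sigma> i where \<sigma>: "\<tau> = block_proj P ` \<sigma>" "finite \<sigma>" "\<sigma> \<noteq> {}" "\<sigma> \<subseteq> X" "i \<in> I" "\<sigma> \<subseteq> U i"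
      unfolding quotient_complex_def co_nerve_def by blast
    have "\<tau> \<subseteq> P"
      using image_mono[OF \<sigma>(4), of "block_proj P"] block_proj_image[OF assms(2)] \<sigma>(1) by simp
    moreover have "\<tau> \<subseteq> block_proj P ` U i"
      using image_mono[OF \<sigma>(6)] \<sigma>(1) by simp
    ultimately show "\<tau> \<in> co_nerve P I (quotient_cover_space P U)"
      using \<sigma>(1,2,3,5) unfolding co_nerve_def quotient_cover_space_def by auto
  qed
  show "co_nerve P I (quotient_cover_space P U) \<subseteq> quotient_complex P (co_nerve X I U)"
  proof
    fix \<tau> assume "\<tau> \<in> co_nerve P I (quotient_cover_space P U)"
    then obtain i where \<tau>: "finite \<tau>" "\<tau> \<noteq> {}" "i \<in> I" "\<tau> \<subseteq> block_proj P ` U i"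
      unfolding co_nerve_def quotient_cover_space_def by blast
    then obtain \<sigma> where \<sigma>: "\<sigma> \<subseteq> U i" "finite \<sigma>" "\<tau> = block_proj P ` \<sigma>"
      by (meson finite_subset_image)
    \<comment> \<open>The cover hypothesis enters here: the members lie in \<open>X\<close>.\<close>
    have "\<sigma> \<subseteq> X" using \<sigma>(1) \<tau>(3) assms(1) unfolding cover_def by blast
    then show "\<tau> \<in> quotient_complex P (co_nerve X I U)"
      using \<sigma> \<tau> unfolding quotient_complex_def co_nerve_def by blast
  qed
qed

text \<open>One point \<open>x\<close> witnesses both nonempty intersections, since \<open>x\<close>
  lies in the union over a block exactly when it lies in \<open>U i\<close> for some
  \<open>i\<close> of that block.\<close>

lemma quotient_complex_nerve:
  assumes "partition_on I P"
  shows "quotient_complex P (nerve I U) = nerve P (quotient_cover_index U)"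
proof
  show "quotient_complex P (nerve I U) \<subseteq> nerve P (quotient_cover_index U)"
  proof
    fix \<tau> assume "\<tau> \<in> quotient_complex P (nerve I U)"
    then obtain \<sigma> x where \<sigma>: "\<tau> = block_proj P ` \<sigma>" "finite \<sigma>" "\<sigma> \<noteq> {}" "\<sigma> \<subseteq> I"
      and x: "\<And>i. i \<in> \<sigma> \<Longrightarrow> x \<in> U i"
      unfolding quotient_complex_def nerve_def by blast
    \<comment> \<open>Each \<open>i\<close> belongs to its own block, so \<open>U i\<close> is
      contained in the merged member of that block.\<close>
    have "x \<in> (\<Inter>B\<in>\<tau>. quotient_cover_index U B)"
      using \<sigma>(1,4) x mem_block_proj[OF assms] unfolding quotient_cover_index_def by auto
    moreover have "\<tau> \<subseteq> P"
      using image_mono[OF \<sigma>(4), of "block_proj P"] block_proj_image[OF assms] \<sigma>(1) by simp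
    ultimately show "\<tau> \<in> nerve P (quotient_cover_index U)"
      using \<sigma>(1,2,3) unfolding nerve_def by auto
  qed
  show "nerve P (quotient_cover_index U) \<subseteq> quotient_complex P (nerve I U)"
  proof
    fix \<tau> assume "\<tau> \<in> nerve P (quotient_cover_index U)"
    then have \<tau>: "finite \<tau>" "\<tau> \<noteq> {}" "\<tau> \<subseteq> P"
      and "(\<Inter>B\<in>\<tau>. quotient_cover_index U B) \<noteq> {}"
      unfolding nerve_def by simp_all
    then obtain x where "x \<in> (\<Inter>B\<in>\<tau>. quotient_cover_index U B)" by auto
    then have "\<forall>B\<in>\<tau>. \<exists>i. i \<in> B \<and> x \<in> U i"
      unfolding quotient_cover_index_def by auto
    from bchoice[OF this] obtain f where f: "\<And>B. B \<in> \<tau> \<Longrightarrow> f B \<in> B" "\<And>B. B \<in> \<tau> \<Longrightarrow> x \<in> U (f B)"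
      by auto
    \<comment> \<open>The choice \<open>f\<close> is a section of the projection over
      \<open>\<tau>\<close>, so its image is a lift projecting exactly onto
      \<open>\<tau>\<close>.\<close>
    have "block_proj P (f B) = B" if "B \<in> \<tau>" for B
      using block_proj_eq[OF assms _ f(1)] \<tau>(3) that by auto
    then have "block_proj P ` f ` \<tau> = \<tau>" by (simp add: image_image)
    moreover have "f ` \<tau> \<in> nerve I U"
    proof -
      have "f ` \<tau> \<subseteq> I" using f(1) \<tau>(3) partition_onD1[OF assms] by auto
      moreover have "x \<in> (\<Inter>i\<in>f ` \<tau>. U i)" using f(2) by simp
      ultimately show ?thesis using \<tau>(1,2) unfolding nerve_def by auto
    qed
    ultimately show "\<tau> \<in> quotient_complex P (nerve I U)"
      unfolding quotient_complex_def
      by (intro CollectI exI[of _ "f ` \<tau>"]) simp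
  qed
qed

theorem corollary4p9:
  fixes X :: "'a set" and I :: "'i set" and U :: "'i \<Rightarrow> 'a set"
    and P_X :: "'a set set" and P_I :: "'i set set"
  assumes "cover X I U"
    and "partition_on X P_X"
    and "partition_on I P_I"
  shows "quotient_complex P_X (co_nerve X I U)
           = co_nerve P_X I (quotient_cover_space P_X U)
       \<and> quotient_complex P_I (nerve I U)
           = nerve P_I (quotient_cover_index U)"
  using quotient_complex_co_nerve[OF assms(1,2)] quotient_complex_nerve[OF assms(3)] by blast

end
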